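(* Let $\alpha,\beta\in\mathbb{K}^*$ be roots of unity with $\alpha\beta\neq 1$ and $\alpha\beta^{-1}\neq 1$ such that $\operatorname{ord}(\alpha\beta)=\operatorname{ord}(\alpha\beta^{-1})=:t$, and let $l=\operatorname{lcm}(\operatorname{ord}(\alpha),\operatorname{ord}(\beta))$. Then the center of $M_2(\alpha,\beta)$ is the $\mathbb{K}$-subalgebra generated by $$X_{11}^l,\ X_{12}^l,\ X_{21}^l,\ X_{22}^l,\ X_{11}^{t}X_{22}^{t}\ \text{ and }\ X_{12}^{t}X_{21}^{t}.$$
   Context: $\mathbb{K}$ is an algebraically closed field of arbitrary characteristic and $\mathbb{K}^*=\mathbb{K}\setminus\{0\}$. For a root of unity $\xi\in\mathbb{K}^*$, $\operatorname{ord}(\xi)$ is its order in the group $\mathbb{K}^*$. For $\alpha,\beta\in\mathbb{K}^*$, the two-parameter quantum matrix algebra $M_2(\alpha,\beta)$ is the associative unital $\mathbb{K}$-algebra generated by $X_{11},X_{12},X_{21},X_{22}$ subject to the relations $X_{12}X_{11}=\alpha X_{11}X_{12}$, $X_{22}X_{21}=\alpha X_{21}X_{22}$, $X_{21}X_{11}=\beta X_{11}X_{21}$, $X_{22}X_{12}=\beta X_{12}X_{22}$, $X_{21}X_{12}=\beta\alpha^{-1}X_{12}X_{21}$, $X_{22}X_{11}-X_{11}X_{22}=(\beta-\alpha^{-1})X_{12}X_{21}$. *)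

theory Defs
  imports "HOL-Algebra.Algebraic_Closure_Type" "HOL-Algebra.QuotRing"
    "HOL-Algebra.Embedded_Algebras" "HOL-Library.Poly_Mapping"
begin

datatype gen = X11 | X12 | X21 | X22

text \<open>
  The free monoid on the four generators, written additively with concatenation as addition,
  so that finitely supported functions on it carry the (noncommutative) convolution product.
\<close>

datatype gen_word = Word (letters: "gen list")

instantiation gen_word :: monoid_add
begin

definition zero_gen_word :: gen_word where
  "0 = Word []"

definition plus_gen_word :: "gen_word \<Rightarrow> gen_word \<Rightarrow> gen_word" where
  "v + w = Word (letters v @ letters w)"

instance
  by standard (simp_all add: zero_gen_word_def plus_gen_word_def)

end

text \<open>The free associative unital algebra on the generators.\<close>

type_synonym 'k free_alg = "gen_word \<Rightarrow>\<^sub>0 'k"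

definition free_gen :: "gen \<Rightarrow> 'k::comm_ring_1 free_alg" where
  "free_gen g = Poly_Mapping.single (Word [g]) 1"

definition free_const :: "'k::comm_ring_1 \<Rightarrow> 'k free_alg" where
  "free_const c = Poly_Mapping.single 0 c"

definition qm_relators :: "'k::field \<Rightarrow> 'k \<Rightarrow> 'k free_alg set" where
  "qm_relators \<alpha> \<beta> =
    (let x11 = free_gen X11; x12 = free_gen X12; x21 = free_gen X21; x22 = free_gen X22 in
      {x12 * x11 - free_const \<alpha> * (x11 * x12),
       x22 * x21 - free_const \<alpha> * (x21 * x22),
       x21 * x11 - free_const \<beta> * (x11 * x21),
       x22 * x12 - free_const \<beta> * (x12 * x22),
       x21 * x12 - free_const (\<beta> * inverse \<alpha>) * (x12 * x21),
       x22 * x11 - x11 * x22 - free_const (\<beta> - inverse \<alpha>) * (x12 * x21)})"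

text \<open>\<^const>\<open>genideal\<close> and \<^const>\<open>ideal\<close> are two-sided.\<close>

definition qm_ideal :: "'k::field \<Rightarrow> 'k \<Rightarrow> 'k free_alg set" where
  "qm_ideal \<alpha> \<beta> = Idl\<^bsub>ring_of_type_algebra\<^esub> (qm_relators \<alpha> \<beta>)"

definition M2 :: "'k::field \<Rightarrow> 'k \<Rightarrow> 'k free_alg set ring" where
  "M2 \<alpha> \<beta> = ring_of_type_algebra Quot (qm_ideal \<alpha> \<beta>)"

definition qm_class :: "'k::field \<Rightarrow> 'k \<Rightarrow> 'k free_alg \<Rightarrow> 'k free_alg set" where
  "qm_class \<alpha> \<beta> p = qm_ideal \<alpha> \<beta> +>\<^bsub>ring_of_type_algebra\<^esub> p"

definition qm_gen :: "'k::field \<Rightarrow> 'k \<Rightarrow> gen \<Rightarrow> 'k free_alg set" where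
  "qm_gen \<alpha> \<beta> g = qm_class \<alpha> \<beta> (free_gen g)"

definition qm_scalars :: "'k::field \<Rightarrow> 'k \<Rightarrow> 'k free_alg set set" where
  "qm_scalars \<alpha> \<beta> = range (\<lambda>c. qm_class \<alpha> \<beta> (free_const c))"

definition ring_center :: "('a, 'b) ring_scheme \<Rightarrow> 'a set" where
  "ring_center A = {z \<in> carrier A. \<forall>a \<in> carrier A. z \<otimes>\<^bsub>A\<^esub> a = a \<otimes>\<^bsub>A\<^esub> z}"

text \<open>
  The library's \<^const>\<open>subalgebra\<close> only asks for an additive subgroup closed under
  multiplication by the scalars; \<^const>\<open>subring\<close> adds the unit and closure under products.
\<close>

definition generated_subalgebra :: "'a set \<Rightarrow> ('a, 'b) ring_scheme \<Rightarrow> 'a set \<Rightarrow> 'a set" where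
  "generated_subalgebra K A S = \<Inter>{B. subring B A \<and> subalgebra K B A \<and> S \<subseteq> B}"

definition mult_ord :: "'k::field \<Rightarrow> nat" where
  "mult_ord \<xi> = group.ord (mult_of ring_of_type_algebra) \<xi>"

definition root_of_unity :: "'k::field \<Rightarrow> bool" where
  "root_of_unity \<xi> \<longleftrightarrow> (\<exists>n>0. \<xi> ^ n = 1)"

end

theory Submission
  imports Defs
begin

text \<open>
  The ordered monomials \<open>X11^i X12^j X21^k X22^m\<close> span \<open>M2 \<alpha> \<beta>\<close>; they are linearly independent because
  left multiplication on them gives a representation of the free algebra that respects the relations.
  Writing a central element in this basis and comparing coefficients in its commutators with
  \<open>X12\<close> and \<open>X21\<close> gives multiplicative conditions on each exponent vector in its support. In the
  commutators with \<open>X11\<close> and \<open>X22\<close> neighbouring coefficients interact through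
  \<open>X22 X11^n = X11^n X22 + \<alpha>^{-1} ((\<alpha>\<beta>)^n - 1) X11^{n-1} X12 X21\<close>, but the interaction vanishes when the
  neighbour has exponents divisible by \<open>t\<close>, so induction on the exponent of \<open>X12\<close> decouples them.
  All exponents are then divisible by \<open>t\<close>, and \<open>\<alpha>^t = \<beta>^t = \<plusminus>1\<close>. If the sign is \<open>+\<close>, then \<open>l = t\<close>;
  otherwise \<open>l = 2t\<close>, and the exponents of \<open>X11\<close> and \<open>X22\<close>, and those of \<open>X12\<close> and \<open>X21\<close>, are
  multiples of \<open>t\<close> of equal parity.
\<close>

section \<open>Free algebras and orders of roots of unity\<close>

lemma ring_of_type_algebra_simps:
  "carrier ring_of_type_algebra = (UNIV :: 'a::ring_1 set)"
  "x \<otimes>\<^bsub>ring_of_type_algebra\<^esub> y = (x * y :: 'a)"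
  "x \<oplus>\<^bsub>ring_of_type_algebra\<^esub> y = (x + y :: 'a)"
  "\<one>\<^bsub>ring_of_type_algebra\<^esub> = (1 :: 'a)"
  "\<zero>\<^bsub>ring_of_type_algebra\<^esub> = (0 :: 'a)"
  by (simp_all add: ring_of_type_algebra_def)

lemma ring_ring_of_type_algebra: "ring (ring_of_type_algebra :: 'a::ring_1 ring)"
proof -
  have "\<exists>y. x + y = 0" for x :: 'a
    using add.right_inverse by blast
  then show ?thesis
    unfolding ring_of_type_algebra_def using add.right_inverse
    by unfold_locales (auto simp: algebra_simps Units_def)
qed

lemma ring_of_type_algebra_uminus: "\<ominus>\<^bsub>ring_of_type_algebra\<^esub> x = (- x :: 'a::ring_1)"
proof -
  interpret ring "ring_of_type_algebra :: 'a ring"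
    by (rule ring_ring_of_type_algebra)
  show ?thesis
    by (rule minus_equality) (simp_all add: ring_of_type_algebra_simps)
qed

lemma ring_of_type_algebra_pow: "x [^]\<^bsub>mult_of ring_of_type_algebra\<^esub> (n::nat) = (x ^ n :: 'k::field)"
  by (induction n) (simp_all add: nat_pow_def ring_of_type_algebra_def)

lemma pow_eq_1_iff_mult_ord_dvd:
  fixes x :: "'k::field"
  assumes "x \<noteq> 0"
  shows "x ^ n = 1 \<longleftrightarrow> mult_ord x dvd n"
proof -
  interpret group "mult_of (ring_of_type_algebra :: 'k ring)"
  proof (rule groupI)
    show "\<exists>y\<in>carrier (mult_of ring_of_type_algebra). y \<otimes>\<^bsub>mult_of ring_of_type_algebra\<^esub> x =
        \<one>\<^bsub>mult_of ring_of_type_algebra\<^esub>"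
      if "x \<in> carrier (mult_of ring_of_type_algebra)" for x :: 'k
      using that by (intro bexI[of _ "inverse x"]) (simp_all add: ring_of_type_algebra_simps)
  qed (simp_all add: ring_of_type_algebra_simps)
  have "x \<in> carrier (mult_of ring_of_type_algebra)"
    using assms by (simp add: ring_of_type_algebra_simps)
  from pow_eq_id[OF this, of n] show ?thesis
    by (simp add: mult_ord_def ring_of_type_algebra_pow)
       (simp add: ring_of_type_algebra_simps)
qed

lemma mult_ord_pos:
  fixes x :: "'k::field"
  assumes "root_of_unity x"
  shows "mult_ord x > 0"
proof -
  obtain n where n: "n > 0" "x ^ n = 1" using assms by (auto simp: root_of_unity_def)
  then have "x \<noteq> 0" by (auto simp: power_0_left)
  with n pow_eq_1_iff_mult_ord_dvd[of x n] show ?thesis by (auto intro: dvd_pos_nat)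
qed

lemma poly_mapping_single_induct [case_names zero single add]:
  assumes "P 0" "\<And>w c. P (Poly_Mapping.single w c)" "\<And>p q. P p \<Longrightarrow> P q \<Longrightarrow> P (p + q)"
  shows "P (p :: 'a \<Rightarrow>\<^sub>0 'b::comm_monoid_add)"
proof (induction p rule: update_induct)
  case const
  show ?case using assms(1) unfolding zero_poly_mapping_def .
next
  case (update p a b)
  have "Poly_Mapping.update a b p = Poly_Mapping.single a b + p"
    using update(1)
    by (intro poly_mapping_eqI) (auto simp: lookup_update lookup_add lookup_single in_keys_iff when_def)
  then show ?case using assms(2,3) update(3) by metis
qed

lemma free_const_add: "free_const (c + d) = free_const c + free_const d"
  by (simp add: free_const_def single_add)

lemma free_const_mult: "free_const (c * d) = free_const c * free_const d"
  by (simp add: free_const_def mult_single)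

lemma free_const_0 [simp]: "free_const 0 = 0"
  by (simp add: free_const_def)

lemma free_const_1 [simp]: "free_const 1 = 1"
  by (simp add: free_const_def)

lemma free_const_comm: "p * free_const c = free_const c * p"
  by (induction p rule: poly_mapping_single_induct)
     (simp_all add: free_const_def mult_single algebra_simps)

lemma free_const_left_comm: "p * (free_const c * q) = free_const c * (p * q)"
  by (metis free_const_comm mult.assoc)

lemma single_Cons:
  "Poly_Mapping.single (Word (x # xs)) c = free_gen x * Poly_Mapping.single (Word xs) (c::'k::comm_ring_1)"
  by (simp add: free_gen_def mult_single plus_gen_word_def)

text \<open>Words are products of generators, so closure under left multiplication by a generator
  replaces the case of a monomial.\<close>

lemma free_alg_induct [case_names const gen add]:
  fixes p :: "'k::comm_ring_1 free_alg"
  assumes const: "\<And>c. P (free_const c)" and gen: "\<And>x p. P p \<Longrightarrow> P (free_gen x * p)"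
    and add: "\<And>p q. P p \<Longrightarrow> P q \<Longrightarrow> P (p + q)"
  shows "P p"
proof (induction p rule: poly_mapping_single_induct)
  case zero
  from const[of 0] show ?case by simp
next
  case (single w c)
  have "P (Poly_Mapping.single (Word xs) c)" for xs
    by (induction xs) (use const[of c] gen in \<open>simp_all add: single_Cons free_const_def zero_gen_word_def\<close>)
  from this[of "letters w"] show ?case by simp
qed (rule add)

section \<open>Exponents modulo the order of a root of unity\<close>

lemma mod_eq_if_power_eq:
  fixes x :: "'k::field"
  assumes ord: "\<And>n. x ^ n = 1 \<longleftrightarrow> t dvd n" and eq: "x ^ p = x ^ q" and "x \<noteq> 0"
  shows "p mod t = q mod t"
  using eq
proof (induction p q rule: linorder_wlog)
  case (le p q)
  have "x ^ q = x ^ p * x ^ (q - p)"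
    using le(1) by (simp flip: power_add)
  with le(2) have "x ^ p * x ^ (q - p) = x ^ p * 1" by simp
  then have "t dvd q - p" using \<open>x \<noteq> 0\<close> by (simp add: ord)
  with le(1) show ?case using mod_eq_dvd_iff_nat by metis
qed auto

lemma power_eq_if_mod_eq:
  fixes x :: "'a::monoid_mult"
  assumes "x ^ t = 1" "p mod t = q mod t"
  shows "x ^ p = x ^ q"
proof -
  have "x ^ p = x ^ (p mod t)" for p
  proof -
    have "x ^ (t * (p div t) + p mod t) = x ^ (p mod t)"
      using assms(1) by (simp only: power_add power_mult) simp
    then show ?thesis by simp
  qed
  with assms(2) show ?thesis by metis
qed

text \<open>The last two hypotheses give \<open>t dvd 2 * p\<close>, and 2 is invertible modulo an
  odd \<open>t\<close>.\<close>

lemma dvd_if_dvd_add_mod_eq: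
  fixes p q t :: nat
  assumes "odd t" "t dvd p + q" "p mod t = q mod t"
  shows "t dvd p"
proof -
  have "(p + p) mod t = (p + q) mod t" using assms(3) by (rule mod_add_cong[OF refl])
  then have "t dvd 2 * p" using assms(2) by (simp add: mult_2 mod_eq_0_iff_dvd)
  moreover have "coprime t 2" using assms(1) by simp
  ultimately show ?thesis by (simp add: coprime_dvd_mult_right_iff)
qed

lemma ideal_qm_ideal: "ideal (qm_ideal \<alpha> \<beta>) ring_of_type_algebra"
  unfolding qm_ideal_def
  by (rule ring.genideal_ideal[OF ring_ring_of_type_algebra]) (simp add: ring_of_type_algebra_simps)

section \<open>Spanning by ordered monomials\<close>

locale quantum_matrices =
  fixes \<alpha> \<beta> :: "'k::field"
  assumes \<alpha>_nonzero [simp]: "\<alpha> \<noteq> 0" and \<beta>_nonzero [simp]: "\<beta> \<noteq> 0"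
begin

section \<open>Congruence modulo the defining ideal\<close>

lemmas additive_subgroup_qm_ideal = ideal.axioms(1)[OF ideal_qm_ideal]

definition qm_cong :: "'k free_alg \<Rightarrow> 'k free_alg \<Rightarrow> bool" (infix \<open>\<approx>\<close> 50)
  where "p \<approx> q \<longleftrightarrow> p - q \<in> qm_ideal \<alpha> \<beta>"

lemma qm_ideal_add: "p \<in> qm_ideal \<alpha> \<beta> \<Longrightarrow> q \<in> qm_ideal \<alpha> \<beta> \<Longrightarrow> p + q \<in> qm_ideal \<alpha> \<beta>"
  using additive_subgroup.a_closed[OF additive_subgroup_qm_ideal] by (simp add: ring_of_type_algebra_simps)

lemma qm_ideal_mult_left: "p \<in> qm_ideal \<alpha> \<beta> \<Longrightarrow> q * p \<in> qm_ideal \<alpha> \<beta>"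
  using ideal.I_l_closed[OF ideal_qm_ideal] by (simp add: ring_of_type_algebra_simps)

lemma qm_ideal_uminus: "p \<in> qm_ideal \<alpha> \<beta> \<Longrightarrow> - p \<in> qm_ideal \<alpha> \<beta>"
  using qm_ideal_mult_left[of p "- 1"] by simp

lemma qm_ideal_mult_right: "p \<in> qm_ideal \<alpha> \<beta> \<Longrightarrow> p * q \<in> qm_ideal \<alpha> \<beta>"
  using ideal.I_r_closed[OF ideal_qm_ideal] by (simp add: ring_of_type_algebra_simps)

lemma cong_refl [simp]: "p \<approx> p"
  using additive_subgroup.zero_closed[OF additive_subgroup_qm_ideal] by (simp add: qm_cong_def ring_of_type_algebra_simps)

lemma cong_sym: "p \<approx> q \<Longrightarrow> q \<approx> p"
  using qm_ideal_uminus[of "p - q"] by (simp add: qm_cong_def)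

lemma cong_trans [trans]: "p \<approx> q \<Longrightarrow> q \<approx> r \<Longrightarrow> p \<approx> r"
  using qm_ideal_add[of "p - q" "q - r"] by (simp add: qm_cong_def)

lemma cong_add: "p \<approx> q \<Longrightarrow> p' \<approx> q' \<Longrightarrow> p + p' \<approx> q + q'"
  using qm_ideal_add[of "p - q" "p' - q'"] by (simp add: qm_cong_def algebra_simps)

lemma cong_mult: "p \<approx> q \<Longrightarrow> p' \<approx> q' \<Longrightarrow> p * p' \<approx> q * q'"
  using qm_ideal_add[of "(p - q) * p'" "q * (p' - q')"]
    qm_ideal_mult_left[of "p' - q'" q] qm_ideal_mult_right[of "p - q" p']
  by (simp add: qm_cong_def algebra_simps)

abbreviation (input) "a \<equiv> free_gen X11 :: 'k free_alg"
abbreviation (input) "b \<equiv> free_gen X12 :: 'k free_alg"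
abbreviation (input) "c \<equiv> free_gen X21 :: 'k free_alg"
abbreviation (input) "d \<equiv> free_gen X22 :: 'k free_alg"
abbreviation (input) "\<gamma> \<equiv> \<beta> * inverse \<alpha>"

definition pbw :: "nat \<Rightarrow> nat \<Rightarrow> nat \<Rightarrow> nat \<Rightarrow> 'k free_alg"
  where "pbw i j k m = a ^ i * (b ^ j * (c ^ k * d ^ m))"

lemma relators_in_ideal: "qm_relators \<alpha> \<beta> \<subseteq> qm_ideal \<alpha> \<beta>"
  unfolding qm_ideal_def
  by (rule ring.genideal_self[OF ring_ring_of_type_algebra]) (simp add: ring_of_type_algebra_simps)

lemma commutation:
  "b * a * r \<approx> free_const \<alpha> * (a * (b * r))"
  "d * c * r \<approx> free_const \<alpha> * (c * (d * r))"
  "c * a * r \<approx> free_const \<beta> * (a * (c * r))"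
  "d * b * r \<approx> free_const \<beta> * (b * (d * r))"
  "c * b * r \<approx> free_const \<gamma> * (b * (c * r))"
  "d * a * r \<approx> a * (d * r) + free_const (\<beta> - inverse \<alpha>) * (b * (c * r))"
proof -
  have rel: "p * r \<approx> q * r" if "p - q \<in> qm_relators \<alpha> \<beta>" for p q
    using that relators_in_ideal by (intro cong_mult) (auto simp: qm_cong_def)
  show "b * a * r \<approx> free_const \<alpha> * (a * (b * r))"
    using rel[of "b * a" "free_const \<alpha> * (a * b)"] by (simp add: qm_relators_def Let_def mult.assoc)
  show "d * c * r \<approx> free_const \<alpha> * (c * (d * r))"
    using rel[of "d * c" "free_const \<alpha> * (c * d)"] by (simp add: qm_relators_def Let_def mult.assoc)
  show "c * a * r \<approx> free_const \<beta> * (a * (c * r))"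
    using rel[of "c * a" "free_const \<beta> * (a * c)"] by (simp add: qm_relators_def Let_def mult.assoc)
  show "d * b * r \<approx> free_const \<beta> * (b * (d * r))"
    using rel[of "d * b" "free_const \<beta> * (b * d)"] by (simp add: qm_relators_def Let_def mult.assoc)
  show "c * b * r \<approx> free_const \<gamma> * (b * (c * r))"
    using rel[of "c * b" "free_const \<gamma> * (b * c)"] by (simp add: qm_relators_def Let_def mult.assoc)
  show "d * a * r \<approx> a * (d * r) + free_const (\<beta> - inverse \<alpha>) * (b * (c * r))"
  proof -
    have "d * a - (a * d + free_const (\<beta> - inverse \<alpha>) * (b * c)) \<in> qm_relators \<alpha> \<beta>"
      by (simp only: diff_diff_add[symmetric]) (simp add: qm_relators_def Let_def)
    from rel[OF this] show ?thesis by (simp only: mult.assoc distrib_right)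
  qed
qed

text \<open>The span of the ordered monomials modulo the ideal, built one term at a time. Explicit
  finite sums of coefficients appear only in \<open>normal_form\<close>.\<close>

inductive normalizable :: "'k free_alg \<Rightarrow> bool" where
  zero: "p \<approx> 0 \<Longrightarrow> normalizable p"
| step: "normalizable q \<Longrightarrow> p \<approx> q + free_const e * pbw i j k m \<Longrightarrow> normalizable p"

lemma normalizable_cong: "p \<approx> q \<Longrightarrow> normalizable q \<Longrightarrow> normalizable p"
  by (erule normalizable.cases) (blast intro: normalizable.intros cong_trans)+

lemma normalizable_add:
  assumes "normalizable p" "normalizable q"
  shows "normalizable (p + q)"
  using assms(2)
proof induction
  case (zero q)
  from cong_add[OF cong_refl zero] show ?case
    using normalizable_cong[OF _ assms(1)] by simp
next
  case (step q p' e i j k m)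
  from cong_add[OF cong_refl step(2), of p]
  show ?case by (intro normalizable.step[OF step(3)]) (simp add: add.assoc)
qed

lemma normalizable_const_mult:
  assumes "normalizable p"
  shows "normalizable (free_const e * p)"
  using assms
proof induction
  case (zero p)
  then show ?case using cong_mult[OF cong_refl zero] normalizable.zero by simp
next
  case (step q p e' i j k m)
  from cong_mult[OF cong_refl step(2), of "free_const e"]
  show ?case
    by (intro normalizable.step[OF step(3), of _ "e * e'"]) (simp add: free_const_mult algebra_simps)
qed

lemma normalizable_pbw: "normalizable (pbw i j k m)"
  by (rule normalizable.step[of 0 _ 1 i j k m]) (auto intro: normalizable.zero)

text \<open>Left multiplication by \<open>x\<close> is additive and commutes with scalars, so it
  suffices to treat ordered monomials.\<close>

lemma normalizable_mult_left:
  assumes "\<And>i j k m. normalizable (x * pbw i j k m)" "normalizable p"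
  shows "normalizable (x * p)"
  using assms(2)
proof induction
  case (zero p)
  then show ?case using cong_mult[OF cong_refl zero] normalizable.zero by simp
next
  case (step q p e i j k m)
  from cong_mult[OF cong_refl step(2), of x]
  have "x * p \<approx> x * q + free_const e * (x * pbw i j k m)"
    by (simp add: free_const_left_comm distrib_left)
  then show ?case
    by (rule normalizable_cong) (intro normalizable_add step normalizable_const_mult assms)
qed

lemma normalizable_a: "normalizable p \<Longrightarrow> normalizable (a * p)"
proof (rule normalizable_mult_left)
  show "normalizable (a * pbw i j k m)" for i j k m
    using normalizable_pbw[of "Suc i" j k m] by (simp add: pbw_def mult.assoc)
qed

text \<open>A generator moves right past one letter at a time. Each swap brings an earlier generator
  to the front, where its own lemma applies; this explains the order \<open>a\<close>,
  \<open>b\<close>, \<open>c\<close>, \<open>d\<close> of the four lemmas.\<close>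

lemma normalizable_b: "normalizable p \<Longrightarrow> normalizable (b * p)"
proof (rule normalizable_mult_left)
  show "normalizable (b * pbw i j k m)" for i j k m
  proof (induction i)
    case 0
    show ?case using normalizable_pbw[of 0 "Suc j" k m] by (simp add: pbw_def mult.assoc)
  next
    case (Suc i)
    have "normalizable (b * a * pbw i j k m)"
      by (intro normalizable_cong[OF commutation(1)] normalizable_const_mult normalizable_a Suc)
    then show ?case by (simp add: pbw_def mult.assoc)
  qed
qed

lemma normalizable_c: "normalizable p \<Longrightarrow> normalizable (c * p)"
proof (rule normalizable_mult_left)
  have 0: "normalizable (c * pbw 0 j k m)" for j k m
  proof (induction j)
    case 0
    show ?case using normalizable_pbw[of 0 0 "Suc k" m] by (simp add: pbw_def mult.assoc)
  next
    case (Suc j)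
    have "normalizable (c * b * pbw 0 j k m)"
      by (intro normalizable_cong[OF commutation(5)] normalizable_const_mult normalizable_b Suc)
    then show ?case by (simp add: pbw_def mult.assoc)
  qed
  show "normalizable (c * pbw i j k m)" for i j k m
  proof (induction i)
    case (Suc i)
    have "normalizable (c * a * pbw i j k m)"
      by (intro normalizable_cong[OF commutation(3)] normalizable_const_mult normalizable_a Suc)
    then show ?case by (simp add: pbw_def mult.assoc)
  qed (rule 0)
qed

lemma normalizable_d: "normalizable p \<Longrightarrow> normalizable (d * p)"
proof (rule normalizable_mult_left)
  have 00: "normalizable (d * pbw 0 0 k m)" for k m
  proof (induction k)
    case 0
    show ?case using normalizable_pbw[of 0 0 0 "Suc m"] by (simp add: pbw_def mult.assoc)
  next
    case (Suc k)
    have "normalizable (d * c * pbw 0 0 k m)"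
      by (intro normalizable_cong[OF commutation(2)] normalizable_const_mult normalizable_c Suc)
    then show ?case by (simp add: pbw_def mult.assoc)
  qed
  have 0: "normalizable (d * pbw 0 j k m)" for j k m
  proof (induction j)
    case (Suc j)
    have "normalizable (d * b * pbw 0 j k m)"
      by (intro normalizable_cong[OF commutation(4)] normalizable_const_mult normalizable_b Suc)
    then show ?case by (simp add: pbw_def mult.assoc)
  qed (rule 00)
  show "normalizable (d * pbw i j k m)" for i j k m
  proof (induction i)
    case (Suc i)
    \<comment> \<open>Swapping \<open>d\<close> with \<open>a\<close> also leaves a multiple of
      \<open>b * (c * pbw i j k m)\<close>, which the lemmas for \<open>b\<close> and
      \<open>c\<close> put in order.\<close>
    have "normalizable (d * a * pbw i j k m)"
      by (intro normalizable_cong[OF commutation(6)] normalizable_add normalizable_const_mult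
          normalizable_a normalizable_b normalizable_c Suc normalizable_pbw)
    then show ?case by (simp add: pbw_def mult.assoc)
  qed (rule 0)
qed

lemma normalizable: "normalizable p"
proof (induction p rule: free_alg_induct)
  case (const e)
  have "normalizable (free_const e * pbw 0 0 0 0)"
    by (intro normalizable_const_mult normalizable_pbw)
  then show ?case by (simp add: pbw_def)
next
  case (gen x p)
  then show ?case
    by (cases x) (auto intro: normalizable_a normalizable_b normalizable_c normalizable_d)
qed (rule normalizable_add)

lemma normal_form:
  obtains K v where "finite K" "p \<approx> (\<Sum>(i,j,k,m)\<in>K. free_const (v (i,j,k,m)) * pbw i j k m)"
proof -
  have "\<exists>K v. finite K \<and> p \<approx> (\<Sum>(i,j,k,m)\<in>K. free_const (v (i,j,k,m)) * pbw i j k m)"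
    using normalizable[of p]
  proof induction
    case (zero p)
    then show ?case by (intro exI[of _ "{}"]) simp
  next
    case (step q p e i j k m)
    then obtain K v where K: "finite K" "q \<approx> (\<Sum>(i,j,k,m)\<in>K. free_const (v (i,j,k,m)) * pbw i j k m)"
      by blast
    \<comment> \<open>Values of \<open>v\<close> outside \<open>K\<close> are arbitrary. Replacing
      them by 0 lets one formula cover both a new exponent vector and one that already lies in
      \<open>K\<close>.\<close>
    let ?w = "(i,j,k,m)" let ?v = "\<lambda>w. if w \<in> K then v w else 0"
    let ?M = "\<lambda>(i,j,k,m). pbw i j k m"
    have "(\<Sum>w\<in>insert ?w K. free_const (?v w + (if w = ?w then e else 0)) * ?M w)
      = (\<Sum>w\<in>insert ?w K. free_const (?v w) * ?M w) + (\<Sum>w\<in>insert ?w K. free_const (if w = ?w then e else 0) * ?M w)"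
      by (simp only: sum.distrib free_const_add distrib_right)
    also have "(\<Sum>w\<in>insert ?w K. free_const (?v w) * ?M w) = (\<Sum>w\<in>K. free_const (v w) * ?M w)"
      using K(1) by (intro sum.mono_neutral_cong_right) auto
    also have "(\<Sum>w\<in>insert ?w K. free_const (if w = ?w then e else 0) * ?M w) = (\<Sum>w\<in>{?w}. free_const e * ?M w)"
      using K(1) by (intro sum.mono_neutral_cong_right) auto
    also have "(\<Sum>w\<in>{?w}. free_const e * ?M w) = free_const e * pbw i j k m"
      by simp
    finally have sum: "(\<Sum>w\<in>insert ?w K. free_const (?v w + (if w = ?w then e else 0)) * ?M w)
      = (\<Sum>w\<in>K. free_const (v w) * ?M w) + free_const e * pbw i j k m" .
    define v' where "v' = (\<lambda>w. ?v w + (if w = ?w then e else 0))"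
    have "p \<approx> (\<Sum>w\<in>insert ?w K. free_const (v' w) * ?M w)"
      using cong_trans[OF step(2) cong_add[OF K(2) cong_refl]]
      unfolding v'_def sum by (simp add: split_def)
    then show ?case using K(1)
      by (intro exI[of _ "insert ?w K"] exI[of _ v']) (simp add: split_def)
  qed
  then show ?thesis using that by blast
qed

section \<open>Linear independence of ordered monomials\<close>

text \<open>In \<open>M2 \<alpha> \<beta>\<close>, \<open>d * a ^ n = a ^ n * d + skew n * a ^ (n - 1) * b * c\<close>.\<close>

definition skew :: "nat \<Rightarrow> 'k" where "skew n = inverse \<alpha> * ((\<alpha> * \<beta>) ^ n - 1)"

lemma skew_0 [simp]: "skew 0 = 0"
  by (simp add: skew_def)

text \<open>The recurrence mirrors \<open>d * a * a ^ n\<close>: the first swap leaves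
  \<open>(\<beta> - inverse \<alpha>)\<close> times \<open>b * c * a ^ n\<close>, and moving
  \<open>a ^ n\<close> to the front costs \<open>(\<alpha> * \<beta>) ^ n\<close>.\<close>

lemma skew_Suc: "skew (Suc n) = skew n + (\<alpha> * \<beta>) ^ n * (\<beta> - inverse \<alpha>)"
  by (simp add: skew_def field_simps)

text \<open>
  Functions on exponent vectors stand for linear forms on the ordered monomials, with
  \<open>gen_act x f\<close> the composition of \<open>f\<close> with left multiplication by \<open>x\<close>; this is a right action.
  The truncated \<open>i - 1\<close> is harmless because \<open>skew 0 = 0\<close>.
\<close>

fun gen_act :: "gen \<Rightarrow> (nat \<Rightarrow> nat \<Rightarrow> nat \<Rightarrow> nat \<Rightarrow> 'k) \<Rightarrow> nat \<Rightarrow> nat \<Rightarrow> nat \<Rightarrow> nat \<Rightarrow> 'k" where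
  "gen_act X11 f i j k m = f (Suc i) j k m"
| "gen_act X12 f i j k m = \<alpha> ^ i * f i (Suc j) k m"
| "gen_act X21 f i j k m = \<beta> ^ i * \<gamma> ^ j * f i j (Suc k) m"
| "gen_act X22 f i j k m = \<beta> ^ j * \<alpha> ^ k * f i j k (Suc m) + skew i * \<gamma> ^ j * f (i - 1) (Suc j) (Suc k) m"

lemma gen_act_linear:
  "gen_act x (\<lambda>i j k m. f i j k m + g i j k m) = (\<lambda>i j k m. gen_act x f i j k m + gen_act x g i j k m)"
  "gen_act x (\<lambda>i j k m. e * f i j k m) = (\<lambda>i j k m. e * gen_act x f i j k m)"
  by (cases x; simp add: fun_eq_iff algebra_simps)+

primrec word_act where
  "word_act [] f = f"
| "word_act (x # xs) f = word_act xs (gen_act x f)"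

lemma word_act_append: "word_act (xs @ ys) f = word_act ys (word_act xs f)"
  by (induction xs arbitrary: f) simp_all

lemma word_act_linear:
  "word_act xs (\<lambda>i j k m. f i j k m + g i j k m) = (\<lambda>i j k m. word_act xs f i j k m + word_act xs g i j k m)"
  "word_act xs (\<lambda>i j k m. e * f i j k m) = (\<lambda>i j k m. e * word_act xs f i j k m)"
  by (induction xs arbitrary: f g) (simp_all add: gen_act_linear)

definition act :: "'k free_alg \<Rightarrow> (nat \<Rightarrow> nat \<Rightarrow> nat \<Rightarrow> nat \<Rightarrow> 'k) \<Rightarrow> nat \<Rightarrow> nat \<Rightarrow> nat \<Rightarrow> nat \<Rightarrow> 'k"
  where "act p f i j k m = (\<Sum>w\<in>Poly_Mapping.keys p. Poly_Mapping.lookup p w * word_act (letters w) f i j k m)"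

lemma act_0 [simp]: "act 0 f i j k m = 0"
  by (simp add: act_def)

lemma act_add: "act (p + q) f i j k m = act p f i j k m + act q f i j k m"
  unfolding act_def
  by (rule setsum_keys_plus_distrib[of "\<lambda>w e. e * word_act (letters w) f i j k m"])
     (simp_all add: distrib_right)

lemma act_single: "act (Poly_Mapping.single w e) f = (\<lambda>i j k m. e * word_act (letters w) f i j k m)"
  by (simp add: fun_eq_iff act_def)

lemma act_linear:
  "act p (\<lambda>i j k m. f i j k m + g i j k m) = (\<lambda>i j k m. act p f i j k m + act p g i j k m)"
  "act p (\<lambda>i j k m. e * f i j k m) = (\<lambda>i j k m. e * act p f i j k m)"
  by (simp_all add: fun_eq_iff act_def word_act_linear sum.distrib sum_distrib_left algebra_simps)

lemma act_zero_fun [simp]: "act p (\<lambda>i j k m. 0) i j k m = 0"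
  using act_linear(2)[of p 0] by (simp add: fun_eq_iff)

text \<open>The order reverses because forms are precomposed: applying \<open>f\<close> after
  multiplication by \<open>p * q\<close> means composing \<open>f\<close> first with
  \<open>p\<close>, then with \<open>q\<close>.\<close>

lemma act_mult: "act (p * q) f = act q (act p f)"
proof (induction p rule: poly_mapping_single_induct)
  case (single w e)
  show ?case
  proof (induction q rule: poly_mapping_single_induct)
    case (single w' e')
    show ?case
      by (simp add: act_single mult_single plus_gen_word_def word_act_append word_act_linear mult_ac)
  qed (simp_all add: fun_eq_iff distrib_left act_add)
next
  case (add p q')
  have "act (p + q') f = (\<lambda>i j k m. act p f i j k m + act q' f i j k m)"
    by (simp add: fun_eq_iff act_add)
  with add show ?case by (simp add: distrib_right fun_eq_iff act_add act_linear)
next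
  case zero
  have "act 0 f = (\<lambda>i j k m. 0)" by (simp add: fun_eq_iff)
  then show ?case by (simp add: fun_eq_iff)
qed

lemma act_const [simp]: "act (free_const e) f i j k m = e * f i j k m"
  by (simp add: free_const_def act_single zero_gen_word_def)

lemma act_1 [simp]: "act 1 f = f"
  using act_const[of 1 f] by (simp add: fun_eq_iff)

lemma act_gen [simp]: "act (free_gen x) f = gen_act x f"
  by (simp add: free_gen_def fun_eq_iff act_single)

lemma act_uminus: "act (- p) f i j k m = - act p f i j k m"
  using act_add[of p "- p" f i j k m] by (simp add: eq_neg_iff_add_eq_0 add.commute)

lemma act_diff: "act (p - q) f i j k m = act p f i j k m - act q f i j k m"
  using act_add[of p "- q" f i j k m] act_uminus[of q f i j k m] by simp

lemma act_relator:
  assumes "r \<in> qm_relators \<alpha> \<beta>"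
  shows "act r f i j k m = 0"
proof -
  \<comment> \<open>This is the consistency check for the structure constants. The split on
    \<open>i\<close> resolves the truncated \<open>i - 1\<close>: for \<open>i = 0\<close> its
    coefficient is 0, and otherwise \<open>skew_Suc\<close> supplies the correction in the last
    relation.\<close>
  have "\<forall>r\<in>qm_relators \<alpha> \<beta>. act r f i j k m = 0"
    by (cases i) (simp_all add: qm_relators_def Let_def act_diff act_add act_mult skew_Suc power_mult_distrib field_simps)
  with assms show ?thesis by blast
qed

text \<open>The elements that annihilate all forms are a two-sided ideal containing the relators,
  hence containing the ideal they generate.\<close>

lemma act_ideal:
  assumes "p \<in> qm_ideal \<alpha> \<beta>"
  shows "act p f i j k m = 0"
proof -
  let ?J = "{p. \<forall>f i j k m. act p f i j k m = 0}"
  interpret R: ring "ring_of_type_algebra :: 'k free_alg ring"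
    by (rule ring_ring_of_type_algebra)
  have "ideal ?J (ring_of_type_algebra :: 'k free_alg ring)"
  proof (rule idealI[OF ring_ring_of_type_algebra])
    have "?J \<noteq> {}" by (auto intro: exI[of _ 0])
    then show "subgroup ?J (add_monoid (ring_of_type_algebra :: 'k free_alg ring))"
      by (intro R.add.subgroupI)
         (auto simp flip: a_inv_def simp: ring_of_type_algebra_simps ring_of_type_algebra_uminus
           act_uminus act_add)
    have zero: "act p f = (\<lambda>i j k m. 0)" if "p \<in> ?J" for p f
      using that by (simp add: fun_eq_iff)
    show "q \<otimes>\<^bsub>ring_of_type_algebra\<^esub> p \<in> ?J" "p \<otimes>\<^bsub>ring_of_type_algebra\<^esub> q \<in> ?J"
      if "p \<in> ?J" for p q
      using zero[OF that] by (simp_all add: ring_of_type_algebra_simps act_mult)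
  qed
  then have "qm_ideal \<alpha> \<beta> \<subseteq> ?J"
    unfolding qm_ideal_def by (rule R.genideal_minimal) (auto intro: act_relator)
  with assms show ?thesis by blast
qed

text \<open>The vector \<open>(0,0,0,0)\<close> belongs to the monomial 1, so this is the value at
  \<open>p\<close> of the linear form that takes the value \<open>f i j k m\<close> at
  \<open>pbw i j k m\<close>.\<close>

definition ev :: "'k free_alg \<Rightarrow> (nat \<Rightarrow> nat \<Rightarrow> nat \<Rightarrow> nat \<Rightarrow> 'k) \<Rightarrow> 'k"
  where "ev p f = act p f 0 0 0 0"

lemma ev_cong: "p \<approx> q \<Longrightarrow> ev p f = ev q f"
  using act_ideal[of "p - q"] by (simp add: qm_cong_def ev_def act_diff)

lemma ev_0 [simp]: "ev 0 f = 0"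
  by (simp add: ev_def)

lemma ev_add: "ev (p + q) f = ev p f + ev q f"
  by (simp add: ev_def act_add)

lemma ev_diff: "ev (p - q) f = ev p f - ev q f"
  by (simp add: ev_def act_diff)

lemma ev_const_mult: "ev (free_const e * p) f = e * ev p f"
proof -
  have "act (free_const e) f = (\<lambda>i j k m. e * f i j k m)"
    by (simp add: fun_eq_iff)
  then show ?thesis by (simp add: ev_def act_mult act_linear)
qed

lemma ev_sum: "ev (sum g K) f = (\<Sum>w\<in>K. ev (g w) f)"
  by (induction K rule: infinite_finite_induct) (simp_all add: ev_add)

section \<open>Multiplication in the ordered basis\<close>

lemma act_power_a: "act (a ^ n) f i j k m = f (i + n) j k m"
  by (induction n arbitrary: f) (simp_all add: act_mult)

lemma act_power_b: "act (b ^ n) f i j k m = \<alpha> ^ (i * n) * f i (j + n) k m"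
  by (induction n arbitrary: f j) (simp_all add: act_mult power_add algebra_simps)

lemma act_power_c: "act (c ^ n) f i j k m = (\<beta> ^ i * \<gamma> ^ j) ^ n * f i j (k + n) m"
  by (induction n arbitrary: f k) (simp_all add: act_mult power_add algebra_simps)

lemma act_power_d_0: "act (d ^ n) f 0 j k m = (\<beta> ^ j * \<alpha> ^ k) ^ n * f 0 j k (m + n)"
  by (induction n arbitrary: f m) (simp_all add: act_mult algebra_simps)

text \<open>In \<open>pbw i j k m * a\<close> the power of \<open>d\<close> meets exactly one
  \<open>a\<close>, so the exponent vectors \<open>(1,0,0,m)\<close> suffice. The formula expresses
  \<open>d ^ n * a = a * d ^ n + skew n * b * c * d ^ (n - 1)\<close> in the quotient.\<close>

lemma act_power_d_1:
  "act (d ^ n) f 1 0 0 m = f 1 0 0 (m + n) + skew n * f 0 1 1 (m + (n - 1))"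
proof (induction n arbitrary: m)
  case (Suc n)
  \<comment> \<open>The two arguments of \<open>f\<close> differ for \<open>n = 0\<close>, but then
    the factor \<open>skew n\<close> is 0.\<close>
  have "skew n * f 0 1 1 (Suc (m + (n - 1))) = skew n * f 0 1 1 (m + n)" by (cases n) auto
  with Suc show ?case
    by (simp add: power_Suc2 act_mult act_power_d_0 skew_Suc power_mult_distrib algebra_simps del: power_Suc)
qed simp

lemma ev_pbw: "ev (pbw i j k m) f = f i j k m"
  by (simp add: ev_def pbw_def act_mult act_power_a act_power_b act_power_c act_power_d_0)

lemma ev_pbw_sum:
  "ev (\<Sum>(i,j,k,m)\<in>K. free_const (v (i,j,k,m)) * pbw i j k m) f = (\<Sum>(i,j,k,m)\<in>K. v (i,j,k,m) * f i j k m)"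
  by (simp add: ev_sum ev_const_mult ev_pbw split_def)

lemma cong_0_iff_ev: "p \<approx> 0 \<longleftrightarrow> (\<forall>f. ev p f = 0)"
proof
  assume ev: "\<forall>f. ev p f = 0"
  obtain K v where K: "finite K" "p \<approx> (\<Sum>(i,j,k,m)\<in>K. free_const (v (i,j,k,m)) * pbw i j k m)"
    by (rule normal_form)
  have "v w = 0" if "w \<in> K" for w
  proof -
    \<comment> \<open>The indicator form of \<open>w\<close> reads off the coefficient of
      \<open>w\<close> in the normal form.\<close>
    have "0 = ev p (\<lambda>i j k m. of_bool (w = (i,j,k,m)))" using ev by simp
    also have "\<dots> = (\<Sum>x\<in>K. if w = x then v x else 0)"
      unfolding ev_cong[OF K(2)] ev_pbw_sum by (intro sum.cong) auto
    also have "\<dots> = v w" using K(1) that by simp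
    finally show ?thesis by simp
  qed
  then have "(\<Sum>(i,j,k,m)\<in>K. free_const (v (i,j,k,m)) * pbw i j k m) = 0"
    by (intro sum.neutral) auto
  with K(2) show "p \<approx> 0" by simp
qed (simp add: ev_cong)

lemma cong_iff_ev: "p \<approx> q \<longleftrightarrow> (\<forall>f. ev p f = ev q f)"
proof -
  have "p \<approx> q \<longleftrightarrow> p - q \<approx> 0" by (simp add: qm_cong_def)
  then show ?thesis by (simp add: cong_0_iff_ev ev_diff)
qed

text \<open>Right multiplication by the generators, to be compared with left multiplication in
  \<open>ev_gen_mult\<close>; through \<open>cong_iff_ev\<close>, commuting with a generator becomes
  an identity between coefficients.\<close>

lemma ev_pbw_mult:
  "ev (pbw i j k m * a) f = \<alpha> ^ j * \<beta> ^ k * f (Suc i) j k m + skew m * \<gamma> ^ k * f i (Suc j) (Suc k) (m - 1)"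
  "ev (pbw i j k m * b) f = \<beta> ^ m * \<gamma> ^ k * f i (Suc j) k m"
  "ev (pbw i j k m * c) f = \<alpha> ^ m * f i j (Suc k) m"
  "ev (pbw i j k m * d) f = f i j k (Suc m)"
  by (simp_all add: ev_def pbw_def act_mult act_power_a act_power_b act_power_c act_power_d_0
      act_power_d_1[unfolded One_nat_def] algebra_simps)

lemma ev_gen_mult: "ev (free_gen x * p) f = ev p (gen_act x f)"
  by (simp add: ev_def act_mult)

lemma commutes_if_commutes_gens:
  assumes "\<And>x. z * free_gen x \<approx> free_gen x * z"
  shows "z * p \<approx> p * z"
proof (induction p rule: free_alg_induct)
  case (const e)
  show ?case by (simp add: free_const_comm)
next
  case (gen x p)
  have "z * (free_gen x * p) \<approx> free_gen x * z * p"
    using cong_mult[OF assms cong_refl, of x p] by (simp add: mult.assoc)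
  also have "free_gen x * z * p \<approx> free_gen x * p * z"
    using cong_mult[OF cong_refl gen, of "free_gen x"] by (simp add: mult.assoc)
  finally show ?case .
next
  case (add p q)
  then show ?case by (simp add: distrib_left distrib_right cong_add)
qed

section \<open>The center\<close>

abbreviation cls :: "'k free_alg \<Rightarrow> 'k free_alg set" where "cls \<equiv> qm_class \<alpha> \<beta>"

sublocale M2: ring "M2 \<alpha> \<beta>"
  unfolding M2_def by (rule ideal.quotient_is_ring[OF ideal_qm_ideal])

sublocale cls: ring_hom_ring "ring_of_type_algebra" "M2 \<alpha> \<beta>" cls
  using ideal.rcos_ring_hom_ring[OF ideal_qm_ideal, of \<alpha> \<beta>]
  by (simp add: M2_def qm_class_def[abs_def])

lemma cls_mult: "cls (p * q) = cls p \<otimes>\<^bsub>M2 \<alpha> \<beta>\<^esub> cls q"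
  using cls.hom_mult[of p q] by (simp add: ring_of_type_algebra_simps)

lemma cls_add: "cls (p + q) = cls p \<oplus>\<^bsub>M2 \<alpha> \<beta>\<^esub> cls q"
  using cls.hom_add[of p q] by (simp add: ring_of_type_algebra_simps)

lemma cls_0: "cls 0 = \<zero>\<^bsub>M2 \<alpha> \<beta>\<^esub>"
  using cls.hom_zero by (simp add: ring_of_type_algebra_simps)

lemma cls_1: "cls 1 = \<one>\<^bsub>M2 \<alpha> \<beta>\<^esub>"
  using cls.hom_one by (simp add: ring_of_type_algebra_simps)

lemma cls_uminus: "cls (- p) = \<ominus>\<^bsub>M2 \<alpha> \<beta>\<^esub> cls p"
  using cls.hom_a_inv[of p] by (simp add: ring_of_type_algebra_simps ring_of_type_algebra_uminus)

lemma cls_power: "cls (p ^ n) = cls p [^]\<^bsub>M2 \<alpha> \<beta>\<^esub> n"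
proof (induction n)
  case (Suc n)
  then show ?case by (simp add: power_Suc2 cls_mult del: power_Suc)
qed (simp add: cls_1)

lemma carrier_M2: "carrier (M2 \<alpha> \<beta>) = range cls"
  by (auto simp: M2_def FactRing_def A_RCOSETS_def' qm_class_def ring_of_type_algebra_simps)

lemma cls_eq_iff: "cls p = cls q \<longleftrightarrow> p \<approx> q"
proof -
  have "cls p = cls q \<longleftrightarrow> cls (p - q) = \<zero>\<^bsub>M2 \<alpha> \<beta>\<^esub>"
    using M2.r_right_minus_eq[of "cls p" "cls q"]
    by (simp add: cls_add cls_uminus carrier_M2 a_minus_def diff_conv_add_uminus del: add_uminus_conv_diff)
  also have "\<dots> \<longleftrightarrow> p - q \<in> qm_ideal \<alpha> \<beta>"
  proof
    have subgroup: "subgroup (qm_ideal \<alpha> \<beta>) (add_monoid ring_of_type_algebra)"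
      by (rule additive_subgroup.a_subgroup[OF additive_subgroup_qm_ideal])
    have zero: "\<zero>\<^bsub>M2 \<alpha> \<beta>\<^esub> = qm_ideal \<alpha> \<beta>"
      by (simp add: M2_def FactRing_def)
    show "p - q \<in> qm_ideal \<alpha> \<beta>" if "cls (p - q) = \<zero>\<^bsub>M2 \<alpha> \<beta>\<^esub>"
      by (rule cls.R.a_coset_join1[OF _ _ subgroup])
         (use that in \<open>simp_all add: zero qm_class_def ring_of_type_algebra_simps\<close>)
    show "cls (p - q) = \<zero>\<^bsub>M2 \<alpha> \<beta>\<^esub>" if "p - q \<in> qm_ideal \<alpha> \<beta>"
      unfolding zero qm_class_def
      by (rule cls.R.a_coset_join2[OF _ subgroup that]) (simp add: ring_of_type_algebra_simps)
  qed
  finally show ?thesis by (simp add: qm_cong_def)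
qed

lemma cls_in_ring_center_iff: "cls z \<in> ring_center (M2 \<alpha> \<beta>) \<longleftrightarrow> (\<forall>p. z * p \<approx> p * z)"
  by (auto simp: ring_center_def carrier_M2 cls_eq_iff simp flip: cls_mult)

lemma subring_subalgebra_ring_center:
  "subring (ring_center (M2 \<alpha> \<beta>)) (M2 \<alpha> \<beta>)"
  "subalgebra (qm_scalars \<alpha> \<beta>) (ring_center (M2 \<alpha> \<beta>)) (M2 \<alpha> \<beta>)"
proof -
  let ?Z = "ring_center (M2 \<alpha> \<beta>)"
  have Z: "\<exists>p. x = cls p \<and> (\<forall>q. p * q \<approx> q * p)" if "x \<in> ?Z" for x
    using that cls_in_ring_center_iff by (auto simp: ring_center_def carrier_M2)
  have ZI: "cls p \<in> ?Z" if "\<And>q. p * q \<approx> q * p" for p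
    using that cls_in_ring_center_iff by blast
  have mult: "x \<otimes>\<^bsub>M2 \<alpha> \<beta>\<^esub> y \<in> ?Z" if xy: "x \<in> ?Z" "y \<in> ?Z" for x y
  proof -
    obtain p p' where *: "x = cls p" "\<And>q. p * q \<approx> q * p" "y = cls p'" "\<And>q. p' * q \<approx> q * p'"
      using Z[OF xy(1)] Z[OF xy(2)] by blast
    have "p * p' * q \<approx> q * (p * p')" for q
    proof -
      have "p * (p' * q) \<approx> p * (q * p')" by (intro cong_mult cong_refl *)
      also have "p * (q * p') \<approx> q * p * p'"
        using cong_mult[OF *(2) cong_refl, of q p'] by (simp add: mult.assoc)
      finally show ?thesis by (simp add: mult.assoc)
    qed
    from ZI[OF this] show ?thesis by (simp add: cls_mult *)
  qed
  show subring: "subring ?Z (M2 \<alpha> \<beta>)"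
  proof (rule M2.subringI)
    show "?Z \<subseteq> carrier (M2 \<alpha> \<beta>)" by (auto simp: ring_center_def)
    show "\<one>\<^bsub>M2 \<alpha> \<beta>\<^esub> \<in> ?Z" using ZI[of 1] by (simp add: cls_1)
    show "\<ominus>\<^bsub>M2 \<alpha> \<beta>\<^esub> x \<in> ?Z" if x: "x \<in> ?Z" for x
    proof -
      obtain p where *: "x = cls p" "\<And>q. p * q \<approx> q * p" using Z x by blast
      have "- p * q \<approx> q * - p" for q
        using cong_mult[OF cong_refl *(2), of "- 1" q] by simp
      from ZI[OF this] show ?thesis by (simp add: cls_uminus *)
    qed
    show "x \<oplus>\<^bsub>M2 \<alpha> \<beta>\<^esub> y \<in> ?Z" if xy: "x \<in> ?Z" "y \<in> ?Z" for x y
    proof -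
      obtain p p' where *: "x = cls p" "\<And>q. p * q \<approx> q * p" "y = cls p'" "\<And>q. p' * q \<approx> q * p'"
        using Z[OF xy(1)] Z[OF xy(2)] by blast
      have "(p + p') * q \<approx> q * (p + p')" for q
        using cong_add[OF *(2,4)] by (simp add: distrib_left distrib_right)
      from ZI[OF this] show ?thesis by (simp add: cls_add *)
    qed
  qed (rule mult)
  have "cls (free_const e) \<in> ?Z" for e
    by (rule ZI) (simp add: free_const_comm)
  then show "subalgebra (qm_scalars \<alpha> \<beta>) ?Z (M2 \<alpha> \<beta>)"
    using subring mult by (auto simp: subring_def qm_scalars_def intro!: subalgebra.intro subalgebra_axioms.intro)
qed

end

text \<open>Orders enter only through the exponents that give 1. In this form the least common
  multiple is the condition that \<open>l dvd n\<close> holds exactly when both \<open>n\<close>-th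
  powers are 1.\<close>

locale equal_order_quantum_matrices = quantum_matrices \<alpha> \<beta> for \<alpha> \<beta> :: "'k::field" +
  fixes t l :: nat
  assumes ord_prod: "\<And>n. (\<alpha> * \<beta>) ^ n = 1 \<longleftrightarrow> t dvd n"
    and ord_quot: "\<And>n. (\<alpha> * inverse \<beta>) ^ n = 1 \<longleftrightarrow> t dvd n"
    and ord_lcm: "\<And>n. \<alpha> ^ n = 1 \<and> \<beta> ^ n = 1 \<longleftrightarrow> l dvd n"
    and l_pos: "l > 0"
begin

section \<open>Exponents under the equal order hypothesis\<close>

lemma power_l [simp]: "\<alpha> ^ l = 1" "\<beta> ^ l = 1"
  using ord_lcm[of l] by auto

lemma t_dvd_l: "t dvd l"
  using ord_prod[of l] by (simp add: power_mult_distrib)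

lemma t_pos: "t > 0"
  using t_dvd_l l_pos by (auto intro: dvd_pos_nat)

lemma quot_power: "(\<alpha> * inverse \<beta>) ^ n = \<alpha> ^ n / \<beta> ^ n"
  by (simp add: divide_inverse power_mult_distrib power_inverse)

lemma quot_power_eq_1_iff: "(\<alpha> * inverse \<beta>) ^ n = 1 \<longleftrightarrow> \<alpha> ^ n = \<beta> ^ n"
  by (simp add: quot_power)

lemma power_eq_if_dvd: "t dvd n \<Longrightarrow> \<alpha> ^ n = \<beta> ^ n"
  using ord_quot[of n] by (simp only: quot_power_eq_1_iff)

lemma power_mult_eq_1_if_dvd: "t dvd n \<Longrightarrow> \<alpha> ^ n * \<beta> ^ n = 1"
  using ord_prod[of n] by (simp only: power_mult_distrib)

lemma gamma_power: "t dvd n \<Longrightarrow> \<gamma> ^ n = 1"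
  using power_eq_if_dvd[of n] by (simp add: power_mult_distrib power_inverse)

lemma skew_eq_0: "t dvd n \<Longrightarrow> skew n = 0"
  using ord_prod[of n] by (simp add: skew_def)

text \<open>For even \<open>t\<close>, both \<open>(\<alpha> * \<beta>) ^ (t div 2)\<close> and \<open>(\<alpha> * inverse \<beta>) ^ (t div 2)\<close> equal \<open>- 1\<close>.\<close>

lemma power_t_if_even:
  assumes "even t"
  shows "\<alpha> ^ t = 1" "\<beta> ^ t = 1"
proof -
  obtain h where h: "t = 2 * h" using assms by blast
  then have "\<not> t dvd h" using t_pos by (auto dest: dvd_imp_le)
  have minus: "x ^ h = - 1" if "\<And>n. x ^ n = 1 \<longleftrightarrow> t dvd n" for x :: 'k
  proof -
    have "(x ^ h)\<^sup>2 = 1" using that[of t] by (simp add: h power_mult mult.commute)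
    moreover have "x ^ h \<noteq> 1" using that \<open>\<not> t dvd h\<close> by simp
    ultimately show ?thesis by (simp add: power2_eq_1_iff)
  qed
  \<comment> \<open>Since \<open>t = 2 * h\<close>, the powers of \<open>\<beta>\<close> cancel and
    \<open>\<alpha> ^ (2 * h)\<close> remains; the two factors are both \<open>- 1\<close>.\<close>
  have "\<alpha> ^ t = (\<alpha> * \<beta>) ^ h * (\<alpha> * inverse \<beta>) ^ h"
    by (simp add: h power_mult_distrib mult_2 power_add power_inverse)
  also have "\<dots> = 1"
    using minus[OF ord_prod] minus[OF ord_quot] by simp
  finally show "\<alpha> ^ t = 1" .
  with power_eq_if_dvd[of t] show "\<beta> ^ t = 1" by simp
qed

text \<open>These vectors index the ordered monomials that span the center:
  \<open>pbw_central\<close> shows that they suffice and \<open>central_support\<close> that no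
  others occur.\<close>

definition central_exponents :: "nat \<Rightarrow> nat \<Rightarrow> nat \<Rightarrow> nat \<Rightarrow> bool" where
  "central_exponents i j k m \<longleftrightarrow>
    t dvd i \<and> t dvd j \<and> t dvd k \<and> t dvd m \<and> \<alpha> ^ i = \<beta> ^ m \<and> \<alpha> ^ j * \<beta> ^ k = 1"

text \<open>Multiplying and dividing the equations in \<open>1\<close> gives
  \<open>t dvd j + k\<close> and \<open>j mod t = k mod t\<close>. For odd \<open>t\<close> this
  yields \<open>t dvd j\<close>; for even \<open>t\<close> the powers \<open>\<beta> ^ j\<close> and
  \<open>\<beta> ^ k\<close> agree, so \<open>(\<alpha> * \<beta>) ^ j = 1\<close>. The same
  argument for \<open>i\<close> and \<open>m\<close> exchanges the roles of
  \<open>\<alpha> * \<beta>\<close> and \<open>\<alpha> * inverse \<beta>\<close>.\<close>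

lemma central_exponentsI:
  assumes 1: "\<alpha> ^ j * \<beta> ^ k = 1" "\<beta> ^ j * \<alpha> ^ k = 1"
    and 2: "\<alpha> ^ (i + k) = \<beta> ^ (m + k)" "\<beta> ^ (i + j) = \<alpha> ^ (m + j)"
  shows "central_exponents i j k m"
proof -
  have nz: "\<alpha> * \<beta> \<noteq> 0" "\<alpha> * inverse \<beta> \<noteq> 0" by simp_all
  have "(\<alpha> * \<beta>) ^ (j + k) = (\<alpha> ^ j * \<beta> ^ k) * (\<beta> ^ j * \<alpha> ^ k)"
    by (simp add: power_mult_distrib power_add)
  then have jk: "t dvd j + k" using 1 by (simp only: ord_prod[symmetric] mult_1)
  have "(\<alpha> * inverse \<beta>) ^ j = (\<alpha> * inverse \<beta>) ^ k"
    using 1 by (simp add: quot_power frac_eq_eq mult.commute)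
  then have jk': "j mod t = k mod t"
    by (rule mod_eq_if_power_eq[OF ord_quot _ nz(2)])
  have j: "t dvd j"
  proof (cases "even t")
    case True
    from power_t_if_even(2)[OF True] jk'[symmetric] have "\<beta> ^ k = \<beta> ^ j"
      by (rule power_eq_if_mod_eq)
    with 1(1) show ?thesis by (simp add: ord_prod[symmetric] power_mult_distrib)
  qed (rule dvd_if_dvd_add_mod_eq[OF _ jk jk'])
  with jk have k: "t dvd k" by (simp add: dvd_add_right_iff)
  have i: "\<alpha> ^ i = \<beta> ^ m" "\<beta> ^ i = \<alpha> ^ m"
    using 2 power_eq_if_dvd[OF k] power_eq_if_dvd[OF j] by (simp_all add: power_add)
  then have "(\<alpha> * \<beta>) ^ i = (\<alpha> * \<beta>) ^ m"
    by (simp add: power_mult_distrib)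
  then have im': "i mod t = m mod t"
    by (rule mod_eq_if_power_eq[OF ord_prod _ nz(1)])
  have "\<alpha> ^ (i + m) = \<beta> ^ (i + m)" using i by (simp add: power_add)
  then have im: "t dvd i + m" by (simp only: ord_quot[symmetric] quot_power_eq_1_iff)
  have "t dvd i"
  proof (cases "even t")
    case True
    from power_t_if_even(2)[OF True] im'[symmetric] have "\<beta> ^ m = \<beta> ^ i"
      by (rule power_eq_if_mod_eq)
    with i(1) show ?thesis by (simp only: ord_quot[symmetric] quot_power_eq_1_iff)
  qed (rule dvd_if_dvd_add_mod_eq[OF _ im im'])
  moreover from this im have "t dvd m" by (simp add: dvd_add_right_iff)
  ultimately show ?thesis
    using j k i 1(1) by (simp add: central_exponents_def)
qed

text \<open>If \<open>\<alpha> ^ t = 1\<close>, then \<open>l dvd t\<close> and the first case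
  holds. Otherwise \<open>\<alpha> ^ t\<close> has square 1, so the quotients of \<open>i\<close>
  and \<open>m\<close> by \<open>t\<close> have equal parity; as \<open>l dvd t * 2\<close>,
  removing one \<open>t\<close> from each in the odd case leaves multiples of
  \<open>l\<close>.\<close>

lemma exponent_pair_cases:
  assumes "t dvd i" "t dvd m" "\<alpha> ^ i = \<beta> ^ m"
  obtains e f where "i = l * e" "m = l * f" | e f where "i = l * e + t" "m = l * f + t"
proof -
  have eps: "\<alpha> ^ t = \<beta> ^ t" using power_eq_if_dvd by simp
  show thesis
  proof (cases "\<alpha> ^ t = 1")
    case True
    then have "l dvd t" using eps ord_lcm[of t] by simp
    with assms(1,2) have "l dvd i" "l dvd m" by (auto intro: dvd_trans)
    then show ?thesis using that(1) by (auto elim!: dvdE)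
  next
    case False
    obtain i' m' where im: "i = t * i'" "m = t * m'" using assms by (auto elim!: dvdE)
    have sq: "(\<alpha> ^ t)\<^sup>2 = 1"
      using power_mult_eq_1_if_dvd[of t] by (simp add: eps power2_eq_square)
    have even: "(\<alpha> ^ t) ^ (2 * n) = 1" for n
      using sq by (simp only: power_mult power_one)
    have parity: "(\<alpha> ^ t) ^ n = (if even n then 1 else \<alpha> ^ t)" for n
    proof (cases "even n")
      case True
      then show ?thesis using even[of "n div 2"] by simp
    next
      case False
      then have "n = Suc (2 * (n div 2))" by simp
      then have "(\<alpha> ^ t) ^ n = \<alpha> ^ t * (\<alpha> ^ t) ^ (2 * (n div 2))" by (metis power_Suc)
      then show ?thesis using False by (simp only: even) simp
    qed
    have "\<alpha> ^ (t * 2) = 1" "\<beta> ^ (t * 2) = 1"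
      using sq eps by (simp_all only: power_mult)
    then have "l dvd t * 2" using ord_lcm by blast
    then obtain r where r: "t * 2 = l * r" by (auto elim: dvdE)
    have "(\<alpha> ^ t) ^ i' = (\<alpha> ^ t) ^ m'" using assms(3) eps by (simp only: im power_mult)
    then have "even i' = even m'" using False by (auto simp: parity split: if_splits)
    then consider e f where "i' = 2 * e" "m' = 2 * f" | e f where "i' = 2 * e + 1" "m' = 2 * f + 1"
      by (cases "even i'") (auto elim!: evenE oddE)
    then show ?thesis
    proof cases
      case 1
      then have "i = l * (r * e)" "m = l * (r * f)" by (simp_all add: im mult.assoc[symmetric] r)
      then show ?thesis by (rule that(1))
    next
      case 2
      then have "i = l * (r * e) + t" "m = l * (r * f) + t"
        by (simp_all add: im mult.assoc[symmetric] r distrib_left)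
      then show ?thesis by (rule that(2))
    qed
  qed
qed

text \<open>Divisibility by \<open>t\<close> makes the skew coefficients vanish and the powers of
  \<open>\<gamma>\<close> trivial. Both products with a generator are then multiples of one ordered
  monomial, and the scalars agree.\<close>

lemma pbw_central:
  assumes "central_exponents i j k m"
  shows "pbw i j k m * p \<approx> p * pbw i j k m"
proof (rule commutes_if_commutes_gens)
  fix x
  note dvd = assms[unfolded central_exponents_def]
  have "\<alpha> ^ m = \<beta> ^ i" "\<beta> ^ j * \<alpha> ^ k = 1"
    using dvd power_eq_if_dvd[of i] power_eq_if_dvd[of m] power_eq_if_dvd[of j] power_eq_if_dvd[of k]
    by simp_all
  with dvd show "pbw i j k m * free_gen x \<approx> free_gen x * pbw i j k m"
    by (cases x) (simp_all add: cong_iff_ev ev_gen_mult ev_pbw ev_pbw_mult skew_eq_0 gamma_power)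
qed

lemma central_support:
  assumes K: "finite K" "z \<approx> (\<Sum>(i,j,k,m)\<in>K. free_const (v (i,j,k,m)) * pbw i j k m)"
    and comm: "\<And>x. z * free_gen x \<approx> free_gen x * z"
  shows "(i,j,k,m) \<in> K \<Longrightarrow> v (i,j,k,m) \<noteq> 0 \<Longrightarrow> central_exponents i j k m"
proof (induction j arbitrary: i k m rule: less_induct)
  case (less j)
  let ?w = "(i,j,k,m)"
  have comm_sum: "(\<Sum>(i,j,k,m)\<in>K. v (i,j,k,m) * (ev (pbw i j k m * free_gen x) f - gen_act x f i j k m)) = 0"
    for x f
  proof -
    let ?S = "\<Sum>(i,j,k,m)\<in>K. free_const (v (i,j,k,m)) * pbw i j k m"
    have "(\<Sum>(i,j,k,m)\<in>K. v (i,j,k,m) * ev (pbw i j k m * free_gen x) f) = ev (?S * free_gen x) f"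
      by (simp add: sum_distrib_right ev_sum split_def mult.assoc ev_const_mult)
    also have "\<dots> = ev (z * free_gen x) f"
      by (rule ev_cong[OF cong_mult[OF cong_sym[OF K(2)] cong_refl]])
    also have "\<dots> = ev (free_gen x * z) f"
      by (rule ev_cong[OF comm])
    also have "\<dots> = ev (free_gen x * ?S) f"
      by (rule ev_cong[OF cong_mult[OF cong_refl K(2)]])
    also have "\<dots> = (\<Sum>(i,j,k,m)\<in>K. v (i,j,k,m) * gen_act x f i j k m)"
      by (simp only: ev_gen_mult ev_pbw_sum)
    finally show ?thesis
      by (simp add: split_def sum_subtractf right_diff_distrib)
  qed
  \<comment> \<open>If the test form sees no other vector of the support, the sum collapses to
    \<open>v ?w * g i j k m\<close>, where \<open>v ?w\<close> is nonzero.\<close>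
  have single: "g i j k m = 0"
    if "\<And>i' j' k' m'. (i',j',k',m') \<in> K \<Longrightarrow> v (i',j',k',m') \<noteq> 0 \<Longrightarrow>
        ev (pbw i' j' k' m' * free_gen x) f - gen_act x f i' j' k' m' = (if (i',j',k',m') = ?w then g i' j' k' m' else 0)"
    for g x f
  proof -
    have "(\<Sum>(i,j,k,m)\<in>K. v (i,j,k,m) * (ev (pbw i j k m * free_gen x) f - gen_act x f i j k m))
        = (\<Sum>w\<in>K. if w = ?w then v ?w * g i j k m else 0)"
    proof (intro sum.cong refl, clarify)
      fix i' j' k' m' assume "(i',j',k',m') \<in> K"
      then show "v (i',j',k',m') * (ev (pbw i' j' k' m' * free_gen x) f - gen_act x f i' j' k' m')
          = (if (i',j',k',m') = ?w then v ?w * g i j k m else 0)"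
        using that[of i' j' k' m'] by (cases "v (i',j',k',m') = 0") auto
    qed
    also have "\<dots> = v ?w * g i j k m"
      using less.prems K(1) by simp
    finally show ?thesis
      using less.prems by (simp add: comm_sum)
  qed
  \<comment> \<open>A skew term raises the exponent of \<open>X12\<close> by one, so interference
    comes only from vectors with \<open>Suc j' = j\<close>; the induction hypothesis removes
    it.\<close>
  have s0: "skew m' = 0 \<and> skew i' = 0" if "(i',j',k',m') \<in> K" "v (i',j',k',m') \<noteq> 0" "Suc j' = j" for i' j' k' m'
    using less.IH[of j' i' k' m'] that by (simp add: central_exponents_def skew_eq_0)
  \<comment> \<open>The test form is the indicator of the monomial obtained from \<open>?w\<close>
    by adding one factor \<open>X11\<close>; the next test does the same with
    \<open>X22\<close>.\<close>
  have "\<alpha> ^ j * \<beta> ^ k - 1 = 0"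
    by (rule single[of X11 "\<lambda>i' j' k' m'. of_bool ((i',j',k',m') = (Suc i,j,k,m))" "\<lambda>i j k m. \<alpha> ^ j * \<beta> ^ k - 1"])
       (use s0 in \<open>auto simp: ev_pbw_mult\<close>)
  moreover have "1 - \<beta> ^ j * \<alpha> ^ k = 0"
    by (rule single[of X22 "\<lambda>i' j' k' m'. of_bool ((i',j',k',m') = (i,j,k,Suc m))" "\<lambda>i j k m. 1 - \<beta> ^ j * \<alpha> ^ k"])
       (use s0 in \<open>auto simp: ev_pbw_mult\<close>)
  \<comment> \<open>Multiplication by \<open>X12\<close> or \<open>X21\<close> on either side sends
    an ordered monomial to a multiple of a single one, so distinct vectors do not interact.\<close>
  moreover have b: "\<beta> ^ m * \<gamma> ^ k - \<alpha> ^ i = 0"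
    by (rule single[of X12 "\<lambda>i' j' k' m'. of_bool ((i',j',k',m') = (i,Suc j,k,m))" "\<lambda>i j k m. \<beta> ^ m * \<gamma> ^ k - \<alpha> ^ i"])
       (auto simp: ev_pbw_mult)
  moreover have c: "\<alpha> ^ m - \<beta> ^ i * \<gamma> ^ j = 0"
    by (rule single[of X21 "\<lambda>i' j' k' m'. of_bool ((i',j',k',m') = (i,j,Suc k,m))" "\<lambda>i j k m. \<alpha> ^ m - \<beta> ^ i * \<gamma> ^ j"])
       (auto simp: ev_pbw_mult)
  \<comment> \<open>Multiplying the last two equations by \<open>\<alpha> ^ k\<close> and
    \<open>\<alpha> ^ j\<close> clears \<open>\<gamma>\<close> and gives the shape required by
    \<open>central_exponentsI\<close>.\<close>
  moreover have cancel: "\<gamma> ^ n * \<alpha> ^ n = \<beta> ^ n" for n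
    by (simp add: mult.assoc flip: power_mult_distrib)
  have "\<alpha> ^ i = \<beta> ^ m * \<gamma> ^ k" "\<alpha> ^ m = \<beta> ^ i * \<gamma> ^ j"
    using b c by simp_all
  then have "\<alpha> ^ (i + k) = \<beta> ^ (m + k)" "\<beta> ^ (i + j) = \<alpha> ^ (m + j)"
    by (simp_all only: power_add mult.assoc cancel)
  ultimately show ?case
    by (intro central_exponentsI) simp_all
qed

theorem ring_center_M2:
  "ring_center (M2 \<alpha> \<beta>) = generated_subalgebra (qm_scalars \<alpha> \<beta>) (M2 \<alpha> \<beta>)
    {cls (a ^ l), cls (b ^ l), cls (c ^ l), cls (d ^ l), cls (a ^ t * d ^ t), cls (b ^ t * c ^ t)}"
  (is "?Z = generated_subalgebra ?K ?M ?S")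
proof
  have central: "cls (pbw i j k m) \<in> ?Z" if "central_exponents i j k m" for i j k m
    using pbw_central[OF that] by (simp add: cls_in_ring_center_iff)
  have "?S \<subseteq> ?Z"
    \<comment> \<open>All six generators are ordered monomials; the two mixed ones have exponent
      vectors \<open>(t,0,0,t)\<close> and \<open>(0,t,t,0)\<close>.\<close>
    using central[of l 0 0 0] central[of 0 l 0 0] central[of 0 0 l 0] central[of 0 0 0 l]
      central[of t 0 0 t] central[of 0 t t 0] t_dvd_l power_eq_if_dvd[of t] power_mult_eq_1_if_dvd[of t]
    by (simp add: central_exponents_def pbw_def)
  then show "generated_subalgebra ?K ?M ?S \<subseteq> ?Z"
    unfolding generated_subalgebra_def using subring_subalgebra_ring_center by blast
  show "?Z \<subseteq> generated_subalgebra ?K ?M ?S"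
    unfolding generated_subalgebra_def
  proof (intro subsetI InterI, clarify)
    fix x B assume x: "x \<in> ?Z" and B: "subring B ?M" "subalgebra ?K B ?M" "?S \<subseteq> B"
    have mult: "cls (p * q) \<in> B" if "cls p \<in> B" "cls q \<in> B" for p q
      using subringE(6)[OF B(1)] that by (simp add: cls_mult)
    have one: "cls 1 \<in> B"
      using subringE(3)[OF B(1)] by (simp add: cls_1)
    have power: "cls (p ^ n) \<in> B" if "cls p \<in> B" for p n
      by (induction n) (simp_all add: one mult that)
    have power_l: "cls (free_gen y ^ (l * n)) \<in> B" for y n
      using B(3) by (cases y) (simp_all add: power_mult power)
    have scale: "cls (free_const e * p) \<in> B" if "cls p \<in> B" for e p
      using subalgebra.smult_closed[OF B(2), of "cls (free_const e)" "cls p"] that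
      by (auto simp: cls_mult qm_scalars_def)
    have pbw: "cls (pbw i j k m) \<in> B" if ex: "central_exponents i j k m" for i j k m
    proof -
      note dvd = ex[unfolded central_exponents_def]
      \<comment> \<open>Both \<open>\<alpha> ^ j\<close> and
        \<open>\<alpha> ^ k = \<beta> ^ k\<close> are inverse to \<open>\<beta> ^ k\<close>; this
        brings \<open>j\<close> and \<open>k\<close> into the form of
        \<open>exponent_pair_cases\<close>.\<close>
      have "\<alpha> ^ j = \<beta> ^ k"
        using dvd power_mult_eq_1_if_dvd[of k] power_eq_if_dvd[of k]
        by (metis mult_right_cancel power_not_zero \<beta>_nonzero)
      with dvd obtain g h where "j = l * g \<and> k = l * h \<or> j = l * g + t \<and> k = l * h + t"
        using exponent_pair_cases[of j k] by metis
      then have bc: "cls (b ^ j * c ^ k) \<in> B"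
      proof (elim disjE conjE; hypsubst_thin)
        show "cls (b ^ (l * g) * c ^ (l * h)) \<in> B" by (intro mult power_l)
        \<comment> \<open>The surplus factors are kept adjacent in the middle, where they form one
          of the given generators.\<close>
        have "cls (b ^ t * c ^ t) \<in> B" using B(3) by simp
        then have "cls (b ^ (l * g) * ((b ^ t * c ^ t) * c ^ (l * h))) \<in> B"
          by (rule mult[OF power_l mult[OF _ power_l]])
        then show "cls (b ^ (l * g + t) * c ^ (l * h + t)) \<in> B"
          by (simp only: power_add mult.assoc add.commute[of "l * h" t])
      qed
      obtain e f where "i = l * e \<and> m = l * f \<or> i = l * e + t \<and> m = l * f + t"
        using dvd exponent_pair_cases[of i m] by metis
      then have ad: "cls (a ^ i * d ^ m) \<in> B"
      proof (elim disjE conjE; hypsubst_thin)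
        show "cls (a ^ (l * e) * d ^ (l * f)) \<in> B" by (intro mult power_l)
        have "cls (a ^ t * d ^ t) \<in> B" using B(3) by simp
        then have "cls (a ^ (l * e) * ((a ^ t * d ^ t) * d ^ (l * f))) \<in> B"
          by (rule mult[OF power_l mult[OF _ power_l]])
        then show "cls (a ^ (l * e + t) * d ^ (l * f + t)) \<in> B"
          by (simp only: power_add mult.assoc add.commute[of "l * f" t])
      qed
      \<comment> \<open>The block \<open>b ^ j * c ^ k\<close> is itself central, so it moves past
        \<open>d ^ m\<close> and the monomial splits into the two blocks already found in
        \<open>B\<close>.\<close>
      have "central_exponents 0 j k 0" using dvd by (simp add: central_exponents_def)
      from pbw_central[OF this, of "d ^ m"]
      have "b ^ j * c ^ k * d ^ m \<approx> d ^ m * (b ^ j * c ^ k)"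
        by (simp add: pbw_def mult.assoc)
      from cong_mult[OF cong_refl this, of "a ^ i"]
      have "a ^ i * (b ^ j * c ^ k * d ^ m) \<approx> a ^ i * (d ^ m * (b ^ j * c ^ k))" .
      then have "cls (pbw i j k m) = cls (a ^ i * d ^ m * (b ^ j * c ^ k))"
        by (simp add: cls_eq_iff pbw_def mult.assoc)
      with mult[OF ad bc] show ?thesis by simp
    qed
    obtain z where z: "x = cls z" using x by (auto simp: ring_center_def carrier_M2)
    obtain K v where K: "finite K" "z \<approx> (\<Sum>(i,j,k,m)\<in>K. free_const (v (i,j,k,m)) * pbw i j k m)"
      by (rule normal_form)
    have comm: "z * free_gen y \<approx> free_gen y * z" for y
      using x cls_in_ring_center_iff z by blast
    have terms: "cls (free_const (v (i,j,k,m)) * pbw i j k m) \<in> B" if "(i,j,k,m) \<in> K" for i j k m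
    proof (cases "v (i,j,k,m) = 0")
      case True
      then show ?thesis using subringE(2)[OF B(1)] by (simp add: cls_0)
    next
      case False
      from central_support[OF K comm that False] show ?thesis
        by (intro scale pbw)
    qed
    have sum: "cls (\<Sum>w\<in>A. g w) \<in> B" if "\<And>w. w \<in> A \<Longrightarrow> cls (g w) \<in> B"
      for A and g :: "nat \<times> nat \<times> nat \<times> nat \<Rightarrow> 'k free_alg"
      using that subringE(2,7)[OF B(1)]
      by (induction A rule: infinite_finite_induct) (simp_all add: cls_0 cls_add)
    have "cls (\<Sum>(i,j,k,m)\<in>K. free_const (v (i,j,k,m)) * pbw i j k m) \<in> B"
      by (rule sum) (use terms in auto)
    then show "x \<in> B" using K(2) z by (simp add: cls_eq_iff[THEN iffD2])
  qed
qed

end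

theorem theorem3p2:
  fixes \<alpha> \<beta> :: "'k::alg_closed_field" and t l :: nat
  assumes "\<alpha> \<noteq> 0" and "\<beta> \<noteq> 0"
    and "root_of_unity \<alpha>" and "root_of_unity \<beta>"
    and "\<alpha> * \<beta> \<noteq> 1" and "\<alpha> * inverse \<beta> \<noteq> 1"
    and "mult_ord (\<alpha> * \<beta>) = t" and "mult_ord (\<alpha> * inverse \<beta>) = t"
    and "l = lcm (mult_ord \<alpha>) (mult_ord \<beta>)"
  shows "ring_center (M2 \<alpha> \<beta>) =
    generated_subalgebra (qm_scalars \<alpha> \<beta>) (M2 \<alpha> \<beta>)
      {qm_gen \<alpha> \<beta> X11 [^]\<^bsub>M2 \<alpha> \<beta>\<^esub> l,
       qm_gen \<alpha> \<beta> X12 [^]\<^bsub>M2 \<alpha> \<beta>\<^esub> l,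
       qm_gen \<alpha> \<beta> X21 [^]\<^bsub>M2 \<alpha> \<beta>\<^esub> l,
       qm_gen \<alpha> \<beta> X22 [^]\<^bsub>M2 \<alpha> \<beta>\<^esub> l,
       (qm_gen \<alpha> \<beta> X11 [^]\<^bsub>M2 \<alpha> \<beta>\<^esub> t) \<otimes>\<^bsub>M2 \<alpha> \<beta>\<^esub> (qm_gen \<alpha> \<beta> X22 [^]\<^bsub>M2 \<alpha> \<beta>\<^esub> t),
       (qm_gen \<alpha> \<beta> X12 [^]\<^bsub>M2 \<alpha> \<beta>\<^esub> t) \<otimes>\<^bsub>M2 \<alpha> \<beta>\<^esub> (qm_gen \<alpha> \<beta> X21 [^]\<^bsub>M2 \<alpha> \<beta>\<^esub> t)}"
proof -
  interpret equal_order_quantum_matrices \<alpha> \<beta> t l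
  proof
    show "\<alpha> \<noteq> 0" "\<beta> \<noteq> 0" by fact+
    show "(\<alpha> * \<beta>) ^ n = 1 \<longleftrightarrow> t dvd n" for n
      using assms pow_eq_1_iff_mult_ord_dvd[of "\<alpha> * \<beta>"] by simp
    show "(\<alpha> * inverse \<beta>) ^ n = 1 \<longleftrightarrow> t dvd n" for n
      using assms pow_eq_1_iff_mult_ord_dvd[of "\<alpha> * inverse \<beta>"] by simp
    show "\<alpha> ^ n = 1 \<and> \<beta> ^ n = 1 \<longleftrightarrow> l dvd n" for n
      using assms by (simp add: pow_eq_1_iff_mult_ord_dvd)
    show "l > 0"
      using assms mult_ord_pos[of \<alpha>] mult_ord_pos[of \<beta>] by (simp add: lcm_pos_nat)
  qed
  show ?thesis
    using ring_center_M2 by (simp only: qm_gen_def cls_power cls_mult)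
qed

end
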